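(* Denote by $k_{H^2(\mathbb{B})}$ and $k_{H^2(\mathbb{H}^+)}$ the reproducing kernels of the quaternionic Hardy space $H^2(\mathbb{B})$ on the unit ball and of the quaternionic Hardy space $H^2(\mathbb{H}^+)$ on the right half-space, respectively. Let $C:\mathbb{B}\to\mathbb{H}^+$ be the Cayley map $C(q)=(1-q)^{-1}(1+q)$. For any $z,w\in\mathbb{H}^+$, the function $k_{H^2(\mathbb{B})}(C^{-1}(w),C^{-1}(z))$ is a rescaling of the reproducing kernel of $H^2(\mathbb{H}^+)$: $$k_{H^2(\mathbb{B})}(C^{-1}(w),C^{-1}(z))=\frac12(1+z)\,k_{H^2(\mathbb{H}^+)}(w,z)\,(1+\overline w).$$
   Context: $\mathbb{H}$ is the skew-field of quaternions, $\mathbb{B}=\{q\in\mathbb{H}:|q|<1\}$, $\mathbb{H}^+=\{q\in\mathbb{H}:\mathrm{Re}(q)>0\}$. The inverse Cayley map is $C^{-1}(q)=(1+q)^{-1}(q-1)$. $H^2(\mathbb{B})$ is the space of power series $f(q)=\sum_{n\ge0}q^na_n$, $a_n\in\mathbb{H}$, with $\sum|a_n|^2<\infty$ and inner product $\langle\sum q^na_n,\sum q^nb_n\rangle=\sum\overline{b_n}a_n$. $H^2(\mathbb{H}^+)$ is the space of functions $f:\mathbb{H}^+\to\mathbb{H}$ of the form $f(q)=\int_0^{+\infty}e^{-\zeta q}F(\zeta)\,d\zeta$ with $F:\mathbb{R}^+\to\mathbb{H}$, $\|f\|^2_{H^2(\mathbb{H}^+)}=\int_0^{+\infty}|F(\zeta)|^2d\zeta<\infty$,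 and inner product $\langle f,g\rangle=\int_0^{+\infty}\overline{G(\zeta)}F(\zeta)\,d\zeta$, where $g(q)=\int_0^{+\infty}e^{-\zeta q}G(\zeta)\,d\zeta$. In both cases the reproducing kernel is written $k(w,q)=k_w(q)$, where $k_w$ is the element of the space such that $f(w)=\langle f,k_w\rangle$ for all $f$ in the space. *)

theory Defs
  imports "HOL-Analysis.Analysis"
begin

section \<open>Quaternions\<close>

codatatype quat = Quat (qRe: real) (qI: real) (qJ: real) (qK: real)

lemma quat_eqI [intro?]:
  "\<lbrakk>qRe x = qRe y; qI x = qI y; qJ x = qJ y; qK x = qK y\<rbrakk> \<Longrightarrow> x = y"
  by (rule quat.expand) simp

lemma quat_eq_iff:
  "x = y \<longleftrightarrow> qRe x = qRe y \<and> qI x = qI y \<and> qJ x = qJ y \<and> qK x = qK y"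
  by (auto intro: quat.expand)

primcorec qcnj :: "quat \<Rightarrow> quat" where
  "qRe (qcnj x) = qRe x"
| "qI (qcnj x) = - qI x"
| "qJ (qcnj x) = - qJ x"
| "qK (qcnj x) = - qK x"

instantiation quat :: real_vector
begin

primcorec zero_quat where
  "qRe 0 = 0" | "qI 0 = 0" | "qJ 0 = 0" | "qK 0 = 0"

primcorec plus_quat where
  "qRe (x + y) = qRe x + qRe y"
| "qI (x + y) = qI x + qI y"
| "qJ (x + y) = qJ x + qJ y"
| "qK (x + y) = qK x + qK y"

primcorec uminus_quat where
  "qRe (- x) = - qRe x"
| "qI (- x) = - qI x"
| "qJ (- x) = - qJ x"
| "qK (- x) = - qK x"

primcorec minus_quat where
  "qRe (x - y) = qRe x - qRe y"
| "qI (x - y) = qI x - qI y"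
| "qJ (x - y) = qJ x - qJ y"
| "qK (x - y) = qK x - qK y"

primcorec scaleR_quat where
  "qRe (scaleR r x) = r * qRe x"
| "qI (scaleR r x) = r * qI x"
| "qJ (scaleR r x) = r * qJ x"
| "qK (scaleR r x) = r * qK x"

instance
  by standard (auto simp: quat_eq_iff algebra_simps)

end

instantiation quat :: ring_1
begin

primcorec one_quat where
  "qRe 1 = 1" | "qI 1 = 0" | "qJ 1 = 0" | "qK 1 = 0"

primcorec times_quat where
  "qRe (x * y) = qRe x * qRe y - qI x * qI y - qJ x * qJ y - qK x * qK y"
| "qI (x * y) = qRe x * qI y + qI x * qRe y + qJ x * qK y - qK x * qJ y"
| "qJ (x * y) = qRe x * qJ y - qI x * qK y + qJ x * qRe y + qK x * qI y"
| "qK (x * y) = qRe x * qK y + qI x * qJ y - qJ x * qI y + qK x * qRe y"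

instance
  by standard (auto simp: quat_eq_iff algebra_simps)

end

instantiation quat :: real_inner
begin

definition inner_quat :: "quat \<Rightarrow> quat \<Rightarrow> real" where
  "inner_quat x y = qRe x * qRe y + qI x * qI y + qJ x * qJ y + qK x * qK y"

definition norm_quat :: "quat \<Rightarrow> real" where
  "norm_quat x = sqrt ((qRe x)\<^sup>2 + (qI x)\<^sup>2 + (qJ x)\<^sup>2 + (qK x)\<^sup>2)"

definition sgn_quat :: "quat \<Rightarrow> quat" where
  "sgn_quat x = x /\<^sub>R norm x"

definition dist_quat :: "quat \<Rightarrow> quat \<Rightarrow> real" where
  "dist_quat x y = norm (x - y)"

definition uniformity_quat :: "(quat \<times> quat) filter" where
  "uniformity_quat = (INF e\<in>{0<..}. principal {(x, y). dist x y < e})"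

definition open_quat :: "quat set \<Rightarrow> bool" where
  "open_quat U \<longleftrightarrow> (\<forall>x\<in>U. eventually (\<lambda>(x', y). x' = x \<longrightarrow> y \<in> U) uniformity)"

instance
proof
  fix x y z :: quat and r :: real
  show "inner x y = inner y x"
    by (simp add: inner_quat_def mult.commute)
  show "inner (x + y) z = inner x z + inner y z"
    by (simp add: inner_quat_def algebra_simps)
  show "inner (scaleR r x) y = r * inner x y"
    by (simp add: inner_quat_def algebra_simps)
  show "0 \<le> inner x x"
    by (simp add: inner_quat_def)
  show "inner x x = 0 \<longleftrightarrow> x = 0"
    unfolding inner_quat_def quat_eq_iff
    by (simp add: add_nonneg_eq_0_iff)
  show "norm x = sqrt (inner x x)"
    by (simp add: norm_quat_def inner_quat_def power2_eq_square)
qed (simp_all add: sgn_quat_def dist_quat_def uniformity_quat_def open_quat_def)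

end

lemma norm_quat_square: "(norm (x::quat))\<^sup>2 = (qRe x)\<^sup>2 + (qI x)\<^sup>2 + (qJ x)\<^sup>2 + (qK x)\<^sup>2"
  by (simp add: norm_quat_def)

lemma mult_qcnj: "x * qcnj x = (norm x)\<^sup>2 *\<^sub>R 1" and qcnj_mult: "qcnj x * x = (norm x)\<^sup>2 *\<^sub>R 1"
  by (simp_all add: quat_eq_iff norm_quat_square algebra_simps) (simp_all add: power2_eq_square)

instantiation quat :: inverse
begin

definition inverse_quat :: "quat \<Rightarrow> quat" where
  "inverse_quat x = qcnj x /\<^sub>R (norm x)\<^sup>2"

definition divide_quat :: "quat \<Rightarrow> quat \<Rightarrow> quat" where
  "divide_quat x y = x * inverse y"

instance ..

end

instance quat :: real_normed_div_algebra
proof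
  fix x y :: quat and a :: real
  show 1: "a *\<^sub>R x * y = a *\<^sub>R (x * y)" for a x and y :: quat
    by (simp add: quat_eq_iff algebra_simps)
  show 2: "x * a *\<^sub>R y = a *\<^sub>R (x * y)" for a x and y :: quat
    by (simp add: quat_eq_iff algebra_simps)
  show "x \<noteq> 0 \<Longrightarrow> inverse x * x = 1"
    by (simp add: inverse_quat_def 1 qcnj_mult)
  show "x \<noteq> 0 \<Longrightarrow> x * inverse x = 1"
    by (simp add: inverse_quat_def 2 mult_qcnj)
  show "x / y = x * inverse y"
    by (simp add: divide_quat_def)
  show "inverse (0::quat) = 0"
    by (simp add: inverse_quat_def)
  have "(norm (x * y))\<^sup>2 = (norm x * norm y)\<^sup>2"
    unfolding power_mult_distrib norm_quat_square times_quat.sel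
    by algebra
  then show "norm (x * y) = norm x * norm y"
    by simp
qed

instantiation quat :: euclidean_space
begin

definition Basis_quat :: "quat set" where
  "Basis_quat = {Quat 1 0 0 0, Quat 0 1 0 0, Quat 0 0 1 0, Quat 0 0 0 1}"

instance
proof
  show "(Basis :: quat set) \<noteq> {}" and "finite (Basis :: quat set)"
    by (simp_all add: Basis_quat_def)
  show "inner u v = (if u = v then 1 else 0)" if "u \<in> Basis" "v \<in> Basis" for u v :: quat
    using that unfolding Basis_quat_def by (elim insertE emptyE) (simp_all add: inner_quat_def)
  show "(\<forall>u\<in>Basis. inner x u = 0) \<longleftrightarrow> x = 0" for x :: quat
    by (simp add: Basis_quat_def inner_quat_def) (simp add: quat_eq_iff)
qed

end


section \<open>The Cayley map\<close>

abbreviation quat_ball :: "quat set"  (\<open>\<bbbB>\<close>) where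
  "\<bbbB> \<equiv> ball 0 1"

definition quat_halfspace :: "quat set"  (\<open>\<bbbH>\<^sup>+\<close>) where
  "\<bbbH>\<^sup>+ = {q. 0 < qRe q}"

definition cayley :: "quat \<Rightarrow> quat" where
  "cayley q = inverse (1 - q) * (1 + q)"

definition cayley_inv :: "quat \<Rightarrow> quat" where
  "cayley_inv q = inverse (1 + q) * (q - 1)"

lemma cayley_inv_cayley:
  assumes "q \<in> \<bbbB>" shows "cayley_inv (cayley q) = q"
proof -
  have ne: "1 - q \<noteq> 0" using assms by auto
  have a: "1 + cayley q = inverse (1 - q) * 2"
  proof -
    have "1 + cayley q = inverse (1 - q) * (1 - q) + inverse (1 - q) * (1 + q)"
      using ne by (simp add: cayley_def)
    also have "\<dots> = inverse (1 - q) * 2"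
      by (simp flip: distrib_left)
    finally show ?thesis .
  qed
  have b: "cayley q - 1 = inverse (1 - q) * (2 * q)"
  proof -
    have "cayley q - 1 = inverse (1 - q) * (1 + q) - inverse (1 - q) * (1 - q)"
      using ne by (simp add: cayley_def)
    also have "\<dots> = inverse (1 - q) * ((1 + q) - (1 - q))"
      by (simp only: right_diff_distrib)
    also have "(1 + q) - (1 - q) = 2 * q"
      by (simp add: mult_2)
    finally show ?thesis .
  qed
  have "(1 + cayley q) * q = cayley q - 1"
    by (simp only: a b mult.assoc)
  moreover have "1 + cayley q \<noteq> 0" using ne by (simp add: a)
  ultimately show ?thesis
    unfolding cayley_inv_def by (metis left_inverse mult.assoc mult_1)
qed

lemma cayley_cayley_inv:
  assumes "q \<in> \<bbbH>\<^sup>+" shows "cayley (cayley_inv q) = q"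
proof -
  have ne: "1 + q \<noteq> 0"
    using assms by (auto simp: quat_halfspace_def quat_eq_iff)
  have a: "1 - cayley_inv q = inverse (1 + q) * 2"
  proof -
    have "1 - cayley_inv q = inverse (1 + q) * (1 + q) - inverse (1 + q) * (q - 1)"
      using ne by (simp add: cayley_inv_def)
    also have "\<dots> = inverse (1 + q) * ((1 + q) - (q - 1))"
      by (simp only: right_diff_distrib)
    also have "(1 + q) - (q - 1) = 2" by simp
    finally show ?thesis .
  qed
  have b: "1 + cayley_inv q = inverse (1 + q) * (2 * q)"
  proof -
    have "1 + cayley_inv q = inverse (1 + q) * (1 + q) + inverse (1 + q) * (q - 1)"
      using ne by (simp add: cayley_inv_def)
    also have "\<dots> = inverse (1 + q) * ((1 + q) + (q - 1))"
      by (simp only: distrib_left)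
    also have "(1 + q) + (q - 1) = 2 * q" by (simp add: mult_2)
    finally show ?thesis .
  qed
  have "(1 - cayley_inv q) * q = 1 + cayley_inv q"
    by (simp only: a b mult.assoc)
  moreover have "1 - cayley_inv q \<noteq> 0" using ne by (simp add: a)
  ultimately show ?thesis
    unfolding cayley_def by (metis left_inverse mult.assoc mult_1)
qed

lemma cayley_inv_in_ball_iff:
  assumes "1 + q \<noteq> 0" shows "cayley_inv q \<in> \<bbbB> \<longleftrightarrow> q \<in> \<bbbH>\<^sup>+"
proof -
  have "norm (cayley_inv q) = norm (q - 1) / norm (1 + q)"
    by (simp add: cayley_inv_def norm_mult norm_inverse divide_inverse mult.commute)
  then have "cayley_inv q \<in> \<bbbB> \<longleftrightarrow> norm (q - 1) < norm (1 + q)"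
    using assms by (simp add: divide_less_eq)
  also have "\<dots> \<longleftrightarrow> (norm (q - 1))\<^sup>2 < (norm (1 + q))\<^sup>2"
    by (metis norm_ge_zero power_less_imp_less_base power_strict_mono zero_less_numeral)
  also have "\<dots> \<longleftrightarrow> 0 < qRe q"
    unfolding norm_quat_square by (simp add: power2_eq_square algebra_simps)
  finally show ?thesis by (simp add: quat_halfspace_def)
qed

lemma bij_betw_cayley: "bij_betw cayley \<bbbB> \<bbbH>\<^sup>+"
proof (rule bij_betw_byWitness[where f' = cayley_inv])
  show "cayley_inv ` \<bbbH>\<^sup>+ \<subseteq> \<bbbB>"
    by (auto simp: cayley_inv_in_ball_iff quat_eq_iff quat_halfspace_def
        simp del: mem_ball mem_ball_0)
  show "cayley ` \<bbbB> \<subseteq> \<bbbH>\<^sup>+"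
  proof
    fix p assume "p \<in> cayley ` \<bbbB>"
    then obtain q where q: "q \<in> \<bbbB>" "p = cayley q" by blast
    then have inv: "cayley_inv p = q" by (simp add: cayley_inv_cayley)
    have ne: "1 - q \<noteq> 0" using q by auto
    have "1 + p = inverse (1 - q) * (1 - q) + inverse (1 - q) * (1 + q)"
      using ne q by (simp add: cayley_def)
    also have "\<dots> = inverse (1 - q) * ((1 - q) + (1 + q))"
      by (simp only: distrib_left)
    finally have "1 + p = inverse (1 - q) * 2" by simp
    then have "1 + p \<noteq> 0" using ne by simp
    with cayley_inv_in_ball_iff[of p] q inv show "p \<in> \<bbbH>\<^sup>+" by simp
  qed
qed (auto intro: cayley_inv_cayley cayley_cayley_inv simp del: mem_ball mem_ball_0)


section \<open>Reproducing kernels\<close>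

text \<open>
  The value \<open>reproducing_kernel S ip w\<close> is the function usually written \<open>k\<^sub>w\<close>, so that
  \<open>reproducing_kernel S ip w q\<close> is \<open>k(w, q)\<close>.
\<close>

definition reproducing_kernel ::
  "(quat \<Rightarrow> quat) set \<Rightarrow> ((quat \<Rightarrow> quat) \<Rightarrow> (quat \<Rightarrow> quat) \<Rightarrow> quat) \<Rightarrow> quat \<Rightarrow> quat \<Rightarrow> quat"
  where "reproducing_kernel S ip w = (THE k. k \<in> S \<and> (\<forall>f\<in>S. f w = ip f k))"


section \<open>The Hardy space of the unit ball\<close>

text \<open>
  Functions on a domain are represented as total functions that are \<open>undefined\<close> off the
  domain (\<open>extensional\<close>), so that equality of functions is equality on the domain.
\<close>

definition ball_coeffs :: "(quat \<Rightarrow> quat) \<Rightarrow> (nat \<Rightarrow> quat) \<Rightarrow> bool" where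
  "ball_coeffs f a \<longleftrightarrow>
     summable (\<lambda>n. (norm (a n))\<^sup>2) \<and> f = (\<lambda>q\<in>\<bbbB>. \<Sum>n. q ^ n * a n)"

definition H2_ball :: "(quat \<Rightarrow> quat) set" where
  "H2_ball = {f. \<exists>a. ball_coeffs f a}"

definition inner_H2_ball :: "(quat \<Rightarrow> quat) \<Rightarrow> (quat \<Rightarrow> quat) \<Rightarrow> quat" where
  "inner_H2_ball f g =
     (let a = (THE a. ball_coeffs f a); b = (THE b. ball_coeffs g b)
      in \<Sum>n. qcnj (b n) * a n)"

definition k_H2_ball :: "quat \<Rightarrow> quat \<Rightarrow> quat" where
  "k_H2_ball = reproducing_kernel H2_ball inner_H2_ball"


section \<open>The Hardy space of the right half-space\<close>

definition laplace_density :: "(quat \<Rightarrow> quat) \<Rightarrow> (real \<Rightarrow> quat) \<Rightarrow> bool" where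
  "laplace_density f F \<longleftrightarrow>
     set_borel_measurable lborel {0<..} F \<and>
     set_integrable lborel {0<..} (\<lambda>\<zeta>. (norm (F \<zeta>))\<^sup>2) \<and>
     f = (\<lambda>q\<in>\<bbbH>\<^sup>+. LBINT \<zeta>:{0<..}. exp (- (\<zeta> *\<^sub>R q)) * F \<zeta>)"

definition H2_halfspace :: "(quat \<Rightarrow> quat) set" where
  "H2_halfspace = {f. \<exists>F. laplace_density f F}"

text \<open>
  The density of a function is determined only up to null sets, hence the choice of a
  representative; the integral does not depend on it.
\<close>

definition inner_H2_halfspace :: "(quat \<Rightarrow> quat) \<Rightarrow> (quat \<Rightarrow> quat) \<Rightarrow> quat" where
  "inner_H2_halfspace f g =
     (let F = (SOME F. laplace_density f F); G = (SOME G. laplace_density g G)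
      in LBINT \<zeta>:{0<..}. qcnj (G \<zeta>) * F \<zeta>)"

definition k_H2_halfspace :: "quat \<Rightarrow> quat \<Rightarrow> quat" where
  "k_H2_halfspace = reproducing_kernel H2_halfspace inner_H2_halfspace"

end

theory Submission
  imports Defs "HOL-Probability.Sinc_Integral"
begin

text \<open>
  Both kernels are explicit. On the ball, \<open>k\<^sub>p\<close> has the coefficients \<open>qcnj p ^ n\<close>, so that
  \<open>B = k(p, q)\<close> is the series of the terms \<open>q\<^sup>n \<cdot> qcnj p\<^sup>n\<close>; on the half-space, \<open>k\<^sub>w\<close> has the density
  \<open>exp (- t qcnj w)\<close>, so that \<open>K = k(w, z)\<close> is the integral of \<open>exp (- t z) \<cdot> exp (- t qcnj w)\<close>. As
  quaternions do not commute, the first is not a geometric series and the second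
  is not the integral of a single exponential; the two are compared through the linear equations
  that they satisfy.

  Shifting the index of the series gives \<open>B - q B qcnj p = 1\<close> (\<open>ball_kernel_equation\<close>), and this
  has only one solution, because \<open>X \<mapsto> q X qcnj p\<close> is a strict contraction
  (\<open>stein_equation_unique\<close>). Integrating the derivative of the integrand over the half-line gives
  \<open>z K + K qcnj w = 1\<close> (\<open>halfspace_kernel_equation\<close>). The Cayley transform turns
  the second equation into the first: if \<open>q = cayley_inv z\<close> and \<open>p = cayley_inv w\<close>, then
  \<open>X = (1 + z) K (1 + qcnj w) / 2\<close> satisfies
  \<open>X - q X qcnj p = ((1 + z) K (1 + qcnj w) - (z - 1) K (qcnj w - 1)) / 2 = z K + K qcnj w = 1\<close>,
  whence \<open>X = B\<close>.

  The analytic work lies in the explicit form of the kernels. The inner products are defined through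
  the coefficients or a density of a function, so these must be determined by the function. For
  power series this is the identity theorem on the real axis. For the half-space it is
  the injectivity of the Laplace transform (\<open>laplace_transform_eq_zero_imp_AE_zero\<close>).
  Once the inner products can be computed from any representing data, each kernel is seen to be the
  only element that reproduces the values at its point: on the ball, testing against the monomials
  determines every coefficient; on the half-space, the difference of two candidates is orthogonal to itself.
\<close>

section \<open>Conjugation and the exponential of quaternions\<close>

lemma qcnj_simps [simp]:
  "qcnj 0 = 0" "qcnj 1 = 1" "qcnj (- x) = - qcnj x" "qcnj (x + y) = qcnj x + qcnj y"
  "qcnj (x - y) = qcnj x - qcnj y" "qcnj (r *\<^sub>R x) = r *\<^sub>R qcnj x"
  "qcnj (x * y) = qcnj y * qcnj x" "qcnj (qcnj x) = x"
  by (simp_all add: quat_eq_iff)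

lemma norm_qcnj [simp]: "norm (qcnj x) = norm x"
  by (simp add: norm_quat_def)

lemma qcnj_power: "qcnj (x ^ n) = qcnj x ^ n"
  by (induction n) (simp_all add: power_commutes)

lemma bounded_linear_qcnj: "bounded_linear qcnj"
  by (rule bounded_linear_intro[where K = 1]) simp_all

lemma qcnj_exp: "qcnj (exp q) = exp (qcnj q)"
proof -
  have "(\<lambda>n. qcnj (q ^ n /\<^sub>R fact n)) sums qcnj (exp q)"
    by (rule bounded_linear.sums[OF bounded_linear_qcnj]) (rule exp_converges)
  then have "(\<lambda>n. qcnj q ^ n /\<^sub>R fact n) sums qcnj (exp q)"
    by (simp add: qcnj_power)
  then show ?thesis
    using exp_converges sums_unique2 by blast
qed

lemma qcnj_inverse: "qcnj (inverse x) = inverse (qcnj x)"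
  by (simp add: inverse_quat_def)

lemma qRe_of_real [simp]: "qRe (of_real r) = r"
  by (simp add: of_real_def)

text \<open>
  A quaternion commutes with its conjugate, and their sum is real; so \<open>exp q\<close> times its
  conjugate is a real exponential.
\<close>

lemma norm_exp_quat: "norm (exp q) = exp (qRe (q::quat))"
proof -
  have sum: "q + qcnj q = of_real (2 * qRe q)"
    by (simp add: of_real_def quat_eq_iff)
  have comm: "q * qcnj q = qcnj q * q"
    by (simp only: mult_qcnj qcnj_mult)
  have "(norm (exp q))\<^sup>2 *\<^sub>R 1 = exp q * exp (qcnj q)"
    by (simp add: mult_qcnj flip: qcnj_exp)
  also have "\<dots> = exp (q + qcnj q)"
    by (rule exp_add_commuting[OF comm, symmetric])
  also have "\<dots> = of_real (exp (2 * qRe q))"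
    by (simp only: sum exp_of_real)
  finally have "of_real ((norm (exp q))\<^sup>2) = (of_real (exp (2 * qRe q)) :: quat)"
    by (simp add: of_real_def)
  then have "(norm (exp q))\<^sup>2 = (exp (qRe q))\<^sup>2"
    by (simp only: of_real_eq_iff exp_double)
  then show ?thesis
    by (simp only: power2_eq_iff_nonneg norm_ge_zero exp_ge_zero)
qed

section \<open>The kernel of the ball\<close>

text \<open>
  This bound makes a product of two square summable sequences summable, and likewise a product of
  two square integrable functions integrable.
\<close>

lemma norm_mult_le_sum_squares:
  fixes x y :: "'a :: real_normed_div_algebra"
  shows "norm (x * y) \<le> (norm x)\<^sup>2 + (norm y)\<^sup>2"
proof -
  have "2 * (norm x * norm y) \<le> (norm x)\<^sup>2 + (norm y)\<^sup>2"
    using sum_squares_bound[of "norm x" "norm y"] by (simp add: mult.assoc)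
  moreover have "0 \<le> norm x * norm y" by simp
  ultimately show ?thesis unfolding norm_mult by linarith
qed

lemma summable_mult_of_square_summable:
  fixes a b :: "nat \<Rightarrow> 'a :: {real_normed_div_algebra, banach}"
  assumes "summable (\<lambda>n. (norm (a n))\<^sup>2)" "summable (\<lambda>n. (norm (b n))\<^sup>2)"
  shows "summable (\<lambda>n. a n * b n)"
  by (rule summable_comparison_test'[where N = 0, OF summable_add[OF assms]])
    (rule norm_mult_le_sum_squares)

lemma square_summable_powers:
  fixes q :: quat
  assumes "q \<in> \<bbbB>"
  shows "summable (\<lambda>n. (norm (q ^ n))\<^sup>2)"
proof -
  have "(norm q)\<^sup>2 < 1" using assms by (simp add: power_less_one_iff abs_square_less_1)
  then have "summable (\<lambda>n. ((norm q)\<^sup>2) ^ n)"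
    by (intro summable_geometric) simp
  then show ?thesis
    by (simp add: norm_power mult.commute flip: power_mult)
qed

text \<open>
  Once the coefficients below \<open>n\<close> vanish, division by \<open>x ^ n\<close> leaves a series with constant term
  \<open>c n\<close>, whose sum is \<open>0\<close> for all small \<open>x \<noteq> 0\<close>.
\<close>

lemma real_powser_eq_0D:
  fixes c :: "nat \<Rightarrow> real"
  assumes "\<And>x. \<bar>x\<bar> < 1 \<Longrightarrow> (\<lambda>n. c n * x ^ n) sums 0"
  shows "c n = 0"
proof (induction n rule: less_induct)
  case (less n)
  have "((\<lambda>_. 0) \<longlongrightarrow> c (0 + n)) (at (0::real))"
  proof (rule powser_limit_0_strong[where s = 1 and a = "\<lambda>m. c (m + n)"])
    fix x :: real
    assume x: "x \<noteq> 0" "norm x < 1"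
    have "(\<lambda>m. c (m + n) * x ^ (m + n)) sums (0 - (\<Sum>m<n. c m * x ^ m))"
      using assms[of x] x by (subst sums_iff_shift) simp
    then have "(\<lambda>m. c (m + n) * x ^ m * x ^ n) sums 0"
      using less by (simp add: power_add mult.assoc)
    then show "(\<lambda>m. c (m + n) * x ^ m) sums 0"
      using x by (metis mult_zero_left power_not_zero sums_mult2_iff)
  qed simp
  then show ?case
    using LIM_const_eq by fastforce
qed

text \<open>
  Real arguments suffice: there each real component of the function is a real power series.
\<close>

lemma ball_coeffs_unique:
  assumes "ball_coeffs f a" "ball_coeffs f b"
  shows "a = b"
proof
  fix n
  have "(a n - b n) \<bullet> u = 0" for u
  proof (rule real_powser_eq_0D[where c = "\<lambda>n. (a n - b n) \<bullet> u"])
    fix x :: real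
    assume x: "\<bar>x\<bar> < 1"
    let ?q = "of_real x :: quat"
    have q: "?q \<in> \<bbbB>" using x by simp
    have s: "(\<lambda>n. ?q ^ n * c n) sums f ?q" if "ball_coeffs f c" for c
      using that summable_mult_of_square_summable[OF square_summable_powers[OF q], of c] q
      by (simp add: ball_coeffs_def sums_iff)
    have "(\<lambda>n. ?q ^ n * a n - ?q ^ n * b n) sums 0"
      using sums_diff[OF s[OF assms(1)] s[OF assms(2)]] by simp
    then have "(\<lambda>n. (?q ^ n * (a n - b n)) \<bullet> u) sums (0 \<bullet> u)"
      by (intro bounded_linear.sums[OF bounded_linear_inner_left]) (simp add: right_diff_distrib)
    moreover have "(?q ^ n * y) \<bullet> u = (y \<bullet> u) * x ^ n" for n y
      by (simp add: scaleR_conv_of_real[symmetric] mult.commute flip: of_real_power)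
    ultimately show "(\<lambda>n. ((a n - b n) \<bullet> u) * x ^ n) sums 0"
      by simp
  qed
  then show "a n = b n"
    by (metis inner_eq_zero_iff right_minus_eq)
qed

lemma inner_H2_ball_eq:
  assumes "ball_coeffs f a" "ball_coeffs g b"
  shows "inner_H2_ball f g = (\<Sum>n. qcnj (b n) * a n)"
proof -
  have "(THE a. ball_coeffs f a) = a" "(THE b. ball_coeffs g b) = b"
    using assms ball_coeffs_unique by blast+
  then show ?thesis
    by (simp add: inner_H2_ball_def)
qed

text \<open>
  The sequence \<open>qcnj p ^ n\<close> reproduces, because \<open>p ^ n = qcnj (qcnj p ^ n)\<close>. Any
  other reproducing element has the same coefficients, as one sees by pairing it with the
  monomials.
\<close>

lemma k_H2_ball_eq:
  assumes p: "p \<in> \<bbbB>" and q: "q \<in> \<bbbB>"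
  shows "k_H2_ball p q = (\<Sum>n. q ^ n * qcnj p ^ n)"
proof -
  let ?b = "\<lambda>n. qcnj p ^ n"
  define k where "k = (\<lambda>q\<in>\<bbbB>. \<Sum>n. q ^ n * ?b n)"
  have k: "ball_coeffs k ?b"
    using square_summable_powers[of "qcnj p"] p by (simp add: ball_coeffs_def k_def)
  have "reproducing_kernel H2_ball inner_H2_ball p = k"
    unfolding reproducing_kernel_def
  proof (rule the_equality)
    have "f p = inner_H2_ball f k" if "ball_coeffs f a" for f a
      using that p by (simp add: inner_H2_ball_eq[OF that k] qcnj_power) (simp add: ball_coeffs_def)
    then show "k \<in> H2_ball \<and> (\<forall>f\<in>H2_ball. f p = inner_H2_ball f k)"
      using k by (auto simp: H2_ball_def)
  next
    fix k'
    assume k': "k' \<in> H2_ball \<and> (\<forall>f\<in>H2_ball. f p = inner_H2_ball f k')"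
    then obtain c where c: "ball_coeffs k' c"
      by (auto simp: H2_ball_def)
    have "c m = ?b m" for m
    proof -
      define e where "e = (\<lambda>n. if n = m then 1 else 0 :: quat)"
      define f where "f = (\<lambda>q\<in>\<bbbB>. \<Sum>n. q ^ n * e n)"
      have "(\<lambda>n. (norm (e n))\<^sup>2) = (\<lambda>n. if n = m then 1 else 0)"
        by (auto simp: e_def)
      then have f: "ball_coeffs f e"
        by (simp add: ball_coeffs_def f_def)
      have single: "(\<Sum>n. x n * e n) = x m" for x
      proof -
        have "(\<lambda>n. x n * e n) = (\<lambda>n. if n = m then x n else 0)"
          by (auto simp: e_def)
        then show ?thesis using sums_single[of m x] by (simp add: sums_iff)
      qed
      have "p ^ m = f p"
        using p by (simp add: f_def single)
      also have "\<dots> = inner_H2_ball f k'"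
        using k' f by (auto simp: H2_ball_def)
      also have "\<dots> = qcnj (c m)"
        by (simp add: inner_H2_ball_eq[OF f c] single)
      finally show ?thesis
        by (metis qcnj_power qcnj_simps(8))
    qed
    then have "c = ?b" by auto
    then show "k' = k"
      using c by (simp add: ball_coeffs_def k_def)
  qed
  then show ?thesis
    using q by (simp add: k_H2_ball_def k_def)
qed

section \<open>Injectivity of the Laplace transform\<close>

text \<open>
  The rays generate the Borel sets and are stable under intersection; the sets over which the
  integral vanishes form a Dynkin system, as the integral over the whole line is \<open>0\<close>.
\<close>

lemma AE_zero_if_integral_rays_zero:
  fixes f :: "real \<Rightarrow> 'b :: {second_countable_topology, banach}"
  assumes f: "integrable lborel f"
    and total: "integral\<^sup>L lborel f = 0"
    and rays: "\<And>a. set_lebesgue_integral lborel {a<..} f = 0"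
  shows "AE x in lborel. f x = 0"
proof (rule sigma_finite_measure.density_zero[OF sigma_finite_lborel f])
  have int: "set_integrable lborel A f" if "A \<in> sets borel" for A
    using f that unfolding set_integrable_def by (intro integrable_mult_indicator) auto
  fix A :: "real set"
  assume "A \<in> sets lborel"
  then have "A \<in> sigma_sets UNIV (range greaterThan)"
    by (simp add: borel_Ioi sets_measure_of)
  then show "set_lebesgue_integral lborel A f = 0"
  proof (rule sigma_sets_induct_disjoint[rotated 2])
    show "Int_stable (range (greaterThan :: real \<Rightarrow> _))"
      by (auto simp: Int_stable_def lessThan_Int_lessThan)
  next
    fix A :: "real set"
    assume A: "A \<in> sigma_sets UNIV (range greaterThan)" "set_lebesgue_integral lborel A f = 0"
    then have [measurable]: "A \<in> sets borel"
      by (simp add: borel_Ioi sets_measure_of)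
    have "set_lebesgue_integral lborel (A \<union> (UNIV - A)) f
        = set_lebesgue_integral lborel A f + set_lebesgue_integral lborel (UNIV - A) f"
      by (intro set_integral_Un int) auto
    with A show "set_lebesgue_integral lborel (UNIV - A) f = 0"
      using total by (simp add: set_lebesgue_integral_def)
  next
    fix A :: "nat \<Rightarrow> real set"
    assume A: "disjoint_family A" "range A \<subseteq> sigma_sets UNIV (range greaterThan)"
      and zero: "\<And>i. set_lebesgue_integral lborel (A i) f = 0"
    then have [measurable]: "A i \<in> sets borel" for i
      by (auto simp: borel_Ioi sets_measure_of)
    have "set_lebesgue_integral lborel (\<Union>i. A i) f = (\<Sum>i. set_lebesgue_integral lborel (A i) f)"
      using A(1) by (intro lebesgue_integral_countable_add int) (auto simp: disjoint_family_on_def)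
    then show "set_lebesgue_integral lborel (\<Union>i. A i) f = 0"
      by (simp add: zero)
  qed (use rays in \<open>auto simp: set_lebesgue_integral_def\<close>)
qed

text \<open>
  With \<open>N\<close> about \<open>exp (n a)\<close>, the power is close to \<open>exp (- exp (n (a - t)))\<close>: the factor
  \<open>1 - exp (- n t)\<close> is within \<open>exp (- n t)\<close> of \<open>1\<close>, which is negligible against \<open>1 / N\<close> for \<open>t > a\<close>
  and dominates it for \<open>t < a\<close>. Thus polynomials in \<open>exp (- t)\<close> approximate the indicator
  of a ray boundedly, in the manner of the Phragmen-Doetsch inversion formula.
\<close>

lemma power_one_minus_exp_tendsto_indicator_ray:
  fixes a t :: real
  assumes t: "t > 0" and ne: "t \<noteq> a"
  shows "(\<lambda>n. (1 - exp (- (real n * t))) ^ nat \<lceil>exp (real n * a)\<rceil>)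
           \<longlonglongrightarrow> indicator {a<..} t"
proof -
  define N where "N n = nat \<lceil>exp (real n * a)\<rceil>" for n
  have N: "exp (real n * a) \<le> real (N n)" "real (N n) \<le> exp (real n * a) + 1" for n
    using ceiling_correct[of "exp (real n * a)"] unfolding N_def
    by (simp_all add: of_nat_nat less_le_trans[OF exp_gt_zero])
  have le1: "exp (- (real n * t)) \<le> 1" for n using t by simp
  have geo: "(\<lambda>n. exp (real n * x)) \<longlonglongrightarrow> 0" if "x < 0" for x :: real
    using that LIMSEQ_realpow_zero[of "exp x"] by (simp add: exp_of_nat_mult)
  show ?thesis
  proof (cases "a < t")
    case True
    have lim: "(\<lambda>n. 1 - (exp (real n * (a - t)) + exp (real n * (- t)))) \<longlonglongrightarrow> 1 - (0 + 0)"
      using t True by (intro tendsto_intros geo) auto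
    have lower: "1 - (exp (real n * (a - t)) + exp (real n * (- t))) \<le> (1 - exp (- (real n * t))) ^ N n" for n
    proof -
      have "real (N n) * exp (- (real n * t)) \<le> (exp (real n * a) + 1) * exp (- (real n * t))"
        by (intro mult_right_mono N) simp
      also have "\<dots> = exp (real n * (a - t)) + exp (real n * (- t))"
        by (simp add: algebra_simps exp_diff exp_minus divide_inverse)
      finally show ?thesis
        using Bernoulli_inequality[of "- exp (- (real n * t))" "N n"] le1[of n] by simp
    qed
    have "(\<lambda>n. (1 - exp (- (real n * t))) ^ N n) \<longlonglongrightarrow> 1"
      by (rule tendsto_sandwich[OF _ _ _ tendsto_const])
        (use lower lim le1 in \<open>auto intro!: always_eventually power_le_one\<close>)
    then show ?thesis using True by (simp add: N_def)
  next
    case False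
    have upper: "(1 - exp (- (real n * t))) ^ N n \<le> exp (real n * (t - a))" for n
    proof -
      have "(1 - exp (- (real n * t))) ^ N n \<le> exp (- exp (- (real n * t))) ^ N n"
        using exp_ge_add_one_self[of "- exp (- (real n * t))"] le1[of n] by (intro power_mono) auto
      also have "\<dots> = exp (- (real (N n) * exp (- (real n * t))))"
        by (simp flip: exp_of_nat_mult)
      also have "\<dots> \<le> exp (- (exp (real n * a) * exp (- (real n * t))))"
        using N(1)[of n] by (simp add: mult_right_mono)
      also have "exp (real n * a) * exp (- (real n * t)) = exp (real n * (a - t))"
        by (simp add: right_diff_distrib flip: exp_add)
      also have "exp (- exp (real n * (a - t))) \<le> exp (- (real n * (a - t)))"
        using exp_ge_add_one_self[of "real n * (a - t)"] by (intro iffD2[OF exp_le_cancel_iff]) linarith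
      finally show ?thesis by (simp add: algebra_simps)
    qed
    have "(\<lambda>n. exp (real n * (t - a))) \<longlonglongrightarrow> 0"
      using False ne by (intro geo) auto
    then have "(\<lambda>n. (1 - exp (- (real n * t))) ^ N n) \<longlonglongrightarrow> 0"
      by (rule tendsto_sandwich[OF _ _ tendsto_const, rotated 2])
        (use upper le1 in \<open>auto intro!: always_eventually\<close>)
    then show ?thesis using False by (simp add: N_def)
  qed
qed

text \<open>
  The integral of \<open>g\<close> against any polynomial in \<open>exp (- t)\<close> vanishes. By dominated convergence along
  \<open>power_one_minus_exp_tendsto_indicator_ray\<close>, so does the integral of \<open>g\<close> over every ray.
\<close>

lemma laplace_transform_eq_zero_imp_AE_zero:
  fixes g :: "real \<Rightarrow> 'b :: {second_countable_topology, banach}"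
  assumes g: "set_integrable lborel {0<..} g"
    and zero: "\<And>s. s \<ge> 0 \<Longrightarrow> (LBINT t:{0<..}. exp (- (s * t)) *\<^sub>R g t) = 0"
  shows "AE t in lborel. 0 < t \<longrightarrow> g t = 0"
proof -
  define h where "h t = indicator {0<..} t *\<^sub>R g t" for t :: real
  have h: "integrable lborel h"
    using g by (simp add: set_integrable_def h_def[abs_def])
  note [measurable] = borel_measurable_integrable[OF h]
  let ?p = "\<lambda>n N s t. (1 - exp (- (n * t))) ^ N * exp (- (s * t)) :: real"
  have p_bound: "\<bar>?p n N s t\<bar> \<le> 1" if "n \<ge> 0" "s \<ge> 0" "t > 0" for n N s t
    using that by (auto simp: abs_mult power_abs intro!: mult_le_one power_le_one)
  have bound: "norm (?p n N s t *\<^sub>R h t) \<le> norm (h t)" if "n \<ge> 0" "s \<ge> 0" for n N s t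
  proof (cases "t > 0")
    case True
    then show ?thesis using mult_right_mono[OF p_bound[OF that True, of N], of "norm (h t)"] by simp
  qed (simp add: h_def)
  have int: "integrable lborel (\<lambda>t. ?p n N s t *\<^sub>R h t)" if "n \<ge> 0" "s \<ge> 0" for n N s
    by (rule Bochner_Integration.integrable_bound[OF h]) (use bound[OF that] in auto)
  \<comment> \<open>The extra factor \<open>exp (- s t)\<close> lets the induction on the exponent proceed without the binomial
    expansion: splitting off one factor \<open>1 - exp (- n t)\<close> shifts \<open>s\<close> by \<open>n\<close>.\<close>
  have poly: "(LBINT t. ?p n N s t *\<^sub>R h t) = 0" if "n \<ge> 0" "s \<ge> 0" for n N s
    using \<open>s \<ge> 0\<close>
  proof (induction N arbitrary: s)
    case 0
    then show ?case
      using zero[of s] by (simp add: set_lebesgue_integral_def h_def mult.commute)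
  next
    case (Suc N)
    have "?p n (Suc N) s t *\<^sub>R h t = ?p n N s t *\<^sub>R h t - ?p n N (s + n) t *\<^sub>R h t" for t
      by (simp add: algebra_simps flip: exp_add scaleR_diff_left)
    then show ?case
      using Suc \<open>n \<ge> 0\<close> by (simp add: int)
  qed
  have "set_lebesgue_integral lborel {a<..} h = 0" for a
  proof -
    have "(\<lambda>n. LBINT t. ?p (real n) (nat \<lceil>exp (real n * a)\<rceil>) 0 t *\<^sub>R h t)
        \<longlonglongrightarrow> (LBINT t. indicator {a<..} t *\<^sub>R h t)"
    proof (rule integral_dominated_convergence[where w = "\<lambda>t. norm (h t)"])
      show "AE t in lborel. (\<lambda>n. ?p (real n) (nat \<lceil>exp (real n * a)\<rceil>) 0 t *\<^sub>R h t)
          \<longlonglongrightarrow> indicator {a<..} t *\<^sub>R h t"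
        using AE_lborel_singleton[of a]
      proof eventually_elim
        case (elim t)
        show ?case
        proof (cases "t > 0")
          case True
          then show ?thesis
            using elim tendsto_scaleR[OF power_one_minus_exp_tendsto_indicator_ray[of t a] tendsto_const[of "h t"]] by simp
        qed (simp add: h_def)
      qed
      show "AE t in lborel. norm (?p (real n) (nat \<lceil>exp (real n * a)\<rceil>) 0 t *\<^sub>R h t) \<le> norm (h t)" for n
        by (rule AE_I2) (rule bound, auto)
    qed (use h in auto)
    moreover have "(LBINT t. ?p (real n) (nat \<lceil>exp (real n * a)\<rceil>) 0 t *\<^sub>R h t) = 0" for n
      by (rule poly) auto
    ultimately show ?thesis
      by (simp add: set_lebesgue_integral_def LIMSEQ_const_iff)
  qed
  then have "AE t in lborel. h t = 0"
    using poly[of 0 0 0] by (intro AE_zero_if_integral_rays_zero[OF h]) simp_all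
  then show ?thesis
    by eventually_elim (auto simp: h_def)
qed

section \<open>The kernel of the half-space\<close>

definition L2_halfline :: "(real \<Rightarrow> quat) \<Rightarrow> bool" where
  "L2_halfline F \<longleftrightarrow> set_borel_measurable lborel {0<..} F \<and>
     set_integrable lborel {0<..} (\<lambda>t. (norm (F t))\<^sup>2)"

definition laplace :: "(real \<Rightarrow> quat) \<Rightarrow> quat \<Rightarrow> quat" where
  "laplace F q = (LBINT t:{0<..}. exp (- (t *\<^sub>R q)) * F t)"

lemma laplace_density_iff:
  "laplace_density f F \<longleftrightarrow> L2_halfline F \<and> f = restrict (laplace F) \<bbbH>\<^sup>+"
  by (auto simp: laplace_density_def L2_halfline_def laplace_def restrict_def)

lemma L2_halfline_mult_integrable:
  assumes "L2_halfline F" "L2_halfline G"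
  shows "set_integrable lborel {0<..} (\<lambda>t. F t * G t)"
  unfolding set_integrable_def
proof (rule Bochner_Integration.integrable_bound)
  show "integrable lborel (\<lambda>t. indicator {0<..} t *\<^sub>R (norm (F t))\<^sup>2 + indicator {0<..} t *\<^sub>R (norm (G t))\<^sup>2)"
    using assms by (intro Bochner_Integration.integrable_add) (auto simp: L2_halfline_def set_integrable_def)
  have "(\<lambda>t. (indicator {0<..} t *\<^sub>R F t) * (indicator {0<..} t *\<^sub>R G t)) \<in> borel_measurable lborel"
    using assms by (intro borel_measurable_times) (auto simp: L2_halfline_def set_borel_measurable_def)
  also have "(\<lambda>t. (indicator {0<..} t *\<^sub>R F t) * (indicator {0<..} t *\<^sub>R G t))
      = (\<lambda>t. indicator {0<..} t *\<^sub>R (F t * G t))"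
    by (auto simp: indicator_def)
  finally show "\<dots> \<in> borel_measurable lborel" .
  show "AE t in lborel. norm (indicator {0<..} t *\<^sub>R (F t * G t))
      \<le> norm (indicator {0<..} t *\<^sub>R (norm (F t))\<^sup>2 + indicator {0<..} t *\<^sub>R (norm (G t))\<^sup>2)"
    using norm_mult_le_sum_squares by (auto simp: indicator_def)
qed

lemma L2_halfline_diff:
  assumes "L2_halfline F" "L2_halfline G"
  shows "L2_halfline (\<lambda>t. F t - G t)"
proof -
  have [measurable]: "(\<lambda>t. indicator {0<..} t *\<^sub>R F t) \<in> borel_measurable lborel"
    "(\<lambda>t. indicator {0<..} t *\<^sub>R G t) \<in> borel_measurable lborel"
    using assms by (auto simp: L2_halfline_def set_borel_measurable_def)
  have eq: "indicator {0<..} t *\<^sub>R (F t - G t) = indicator {0<..} t *\<^sub>R F t - indicator {0<..} t *\<^sub>R G t" for t :: real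
    by (rule scaleR_diff_right)
  have meas [measurable]: "(\<lambda>t. indicator {0<..} t *\<^sub>R (F t - G t)) \<in> borel_measurable lborel"
    unfolding eq by measurable
  have "integrable lborel (\<lambda>t. indicator {0<..} t *\<^sub>R (norm (F t - G t))\<^sup>2)"
  proof (rule Bochner_Integration.integrable_bound)
    show "integrable lborel (\<lambda>t. 2 * (indicator {0<..} t *\<^sub>R (norm (F t))\<^sup>2 + indicator {0<..} t *\<^sub>R (norm (G t))\<^sup>2))"
      using assms by (intro integrable_mult_right Bochner_Integration.integrable_add)
        (auto simp: L2_halfline_def set_integrable_def)
    have "(\<lambda>t. (norm (indicator {0<..} t *\<^sub>R (F t - G t)))\<^sup>2) \<in> borel_measurable lborel"
      by measurable
    also have "(\<lambda>t. (norm (indicator {0<..} t *\<^sub>R (F t - G t)))\<^sup>2)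
        = (\<lambda>t. indicator {0<..} t *\<^sub>R (norm (F t - G t))\<^sup>2)"
      by (auto simp: indicator_def)
    finally show "\<dots> \<in> borel_measurable lborel" .
    have "(norm (F t - G t))\<^sup>2 \<le> 2 * ((norm (F t))\<^sup>2 + (norm (G t))\<^sup>2)" for t
    proof -
      have "(norm (F t - G t))\<^sup>2 \<le> (norm (F t) + norm (G t))\<^sup>2"
        by (intro power_mono norm_triangle_ineq4) simp
      also have "\<dots> \<le> 2 * ((norm (F t))\<^sup>2 + (norm (G t))\<^sup>2)"
        using sum_squares_bound[of "norm (F t)" "norm (G t)"] by (simp add: power2_sum)
      finally show ?thesis .
    qed
    then show "AE t in lborel. norm (indicator {0<..} t *\<^sub>R (norm (F t - G t))\<^sup>2)
        \<le> norm (2 * (indicator {0<..} t *\<^sub>R (norm (F t))\<^sup>2 + indicator {0<..} t *\<^sub>R (norm (G t))\<^sup>2))"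
      by (auto simp: indicator_def)
  qed
  with meas show ?thesis
    by (simp add: L2_halfline_def set_borel_measurable_def set_integrable_def)
qed

lemma L2_halfline_qcnj:
  assumes "L2_halfline F"
  shows "L2_halfline (\<lambda>t. qcnj (F t))"
proof -
  have "qcnj \<in> borel_measurable borel"
    by (intro borel_measurable_continuous_onI linear_continuous_on bounded_linear_qcnj)
  then have "(\<lambda>t. qcnj (indicator {0<..} t *\<^sub>R F t)) \<in> borel_measurable lborel"
    by (rule measurable_compose[rotated]) (use assms in \<open>simp add: L2_halfline_def set_borel_measurable_def\<close>)
  then show ?thesis
    using assms by (simp add: L2_halfline_def set_borel_measurable_def)
qed

lemma norm_exp_scaleR: "norm (exp (- (t *\<^sub>R q))) = exp (- (t * qRe q))"
  by (simp add: norm_exp_quat)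

lemma isCont_exp_scaleR: "isCont (\<lambda>t. exp (- (t *\<^sub>R q))) t" for q :: quat
  using has_vector_derivative_continuous[OF exp_scaleR_has_vector_derivative_left[of "- q" t]]
  by simp

lemma L2_halfline_exp:
  assumes "q \<in> \<bbbH>\<^sup>+"
  shows "L2_halfline (\<lambda>t. exp (- (t *\<^sub>R q)))"
proof -
  have "(\<lambda>t. exp (- (t *\<^sub>R q))) \<in> borel_measurable borel"
    using isCont_exp_scaleR
    by (intro borel_measurable_continuous_onI continuous_at_imp_continuous_on) blast
  then have "set_borel_measurable lborel {0<..} (\<lambda>t. exp (- (t *\<^sub>R q)))"
    unfolding set_borel_measurable_def by (intro borel_measurable_scaleR) auto
  moreover have "set_integrable lborel {0<..} (\<lambda>t. exp (- (t * (2 * qRe q))))"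
    using assms by (intro integrable_I0i_exp_mscale) (simp add: quat_halfspace_def)
  moreover have "(norm (exp (- (t *\<^sub>R q))))\<^sup>2 = exp (- (t * (2 * qRe q)))" for t
    by (simp add: norm_exp_scaleR mult.left_commute flip: exp_double)
  ultimately show ?thesis
    by (simp add: L2_halfline_def)
qed

lemma laplace_integrable:
  assumes "L2_halfline F" "q \<in> \<bbbH>\<^sup>+"
  shows "set_integrable lborel {0<..} (\<lambda>t. exp (- (t *\<^sub>R q)) * F t)"
  by (intro L2_halfline_mult_integrable L2_halfline_exp assms)

text \<open>
  On the real axis the two transforms are ordinary Laplace transforms with values in the quaternions.
  A square integrable density need not be integrable, so the abscissas \<open>1 + s\<close> are used and
  one factor \<open>exp (- t)\<close> is absorbed into the density.
\<close>

lemma laplace_density_unique: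
  assumes F: "laplace_density f F" and G: "laplace_density f G"
  shows "AE t in lborel. 0 < t \<longrightarrow> F t = G t"
proof -
  let ?D = "\<lambda>t. F t - G t"
  have L2: "L2_halfline F" "L2_halfline G"
    and eq: "restrict (laplace F) \<bbbH>\<^sup>+ = restrict (laplace G) \<bbbH>\<^sup>+"
    using F G by (simp_all add: laplace_density_iff)
  have L2_D: "L2_halfline ?D"
    by (rule L2_halfline_diff) fact+
  have pos: "of_real (1 + s) \<in> \<bbbH>\<^sup>+" if "s \<ge> 0" for s
    using that unfolding quat_halfspace_def mem_Collect_eq qRe_of_real by simp
  have exp_eq: "exp (- (t *\<^sub>R of_real (1 + s))) * x = exp (- (s * t)) *\<^sub>R (exp (- t) *\<^sub>R x)"
    for s t and x :: quat
  proof -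
    have "exp (- (t *\<^sub>R of_real (1 + s))) = (exp (of_real (- (s * t) - t)) :: quat)"
      by (rule arg_cong[where f = exp]) (simp add: of_real_def algebra_simps)
    also have "\<dots> = of_real (exp (- (s * t)) * exp (- t))"
      unfolding exp_of_real by (simp add: exp_diff exp_minus divide_inverse)
    finally show ?thesis
      by (simp add: of_real_def)
  qed
  have "AE t in lborel. 0 < t \<longrightarrow> exp (- t) *\<^sub>R ?D t = 0"
  proof (rule laplace_transform_eq_zero_imp_AE_zero)
    show "set_integrable lborel {0<..} (\<lambda>t. exp (- t) *\<^sub>R ?D t)"
      using laplace_integrable[OF L2_D pos[of 0]] exp_eq[of _ 0] by simp
  next
    fix s :: real
    assume s: "s \<ge> 0"
    have "laplace F (of_real (1 + s)) = laplace G (of_real (1 + s))"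
      using fun_cong[OF eq, of "of_real (1 + s)"] pos[OF s] by simp
    then have "(LBINT t:{0<..}. exp (- (t *\<^sub>R of_real (1 + s))) * ?D t) = 0"
      using laplace_integrable[OF _ pos[OF s]] L2
      by (simp add: laplace_def right_diff_distrib set_integral_diff)
    then show "(LBINT t:{0<..}. exp (- (s * t)) *\<^sub>R (exp (- t) *\<^sub>R ?D t)) = 0"
      unfolding exp_eq .
  qed
  then show ?thesis
    by eventually_elim simp
qed

text \<open>
  The inner product refers to an arbitrary choice of densities; any other densities agree with
  the chosen ones almost everywhere.
\<close>

lemma inner_H2_halfspace_eq:
  assumes F: "laplace_density f F" and G: "laplace_density g G"
  shows "inner_H2_halfspace f g = (LBINT t:{0<..}. qcnj (G t) * F t)"
proof -
  define F' where "F' = (SOME F. laplace_density f F)"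
  define G' where "G' = (SOME G. laplace_density g G)"
  have F': "laplace_density f F'" and G': "laplace_density g G'"
    unfolding F'_def G'_def using F G someI_ex[of "laplace_density f"] someI_ex[of "laplace_density g"]
    by blast+
  have meas: "(\<lambda>t. indicator {0<..} t *\<^sub>R (qcnj (K t) * H t)) \<in> borel_measurable lborel"
    if "laplace_density f H" "laplace_density g K" for H K
    using L2_halfline_mult_integrable[OF L2_halfline_qcnj, of K H] that
    by (auto simp: laplace_density_iff set_integrable_def)
  have "(LBINT t:{0<..}. qcnj (G' t) * F' t) = (LBINT t:{0<..}. qcnj (G t) * F t)"
    unfolding set_lebesgue_integral_def
  proof (rule integral_cong_AE)
    show "AE t in lborel. indicator {0<..} t *\<^sub>R (qcnj (G' t) * F' t)
        = indicator {0<..} t *\<^sub>R (qcnj (G t) * F t)"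
      using laplace_density_unique[OF F' F] laplace_density_unique[OF G' G]
      by eventually_elim (auto simp: indicator_def)
  qed (rule meas, fact+)+
  then show ?thesis
    by (simp add: inner_H2_halfspace_def F'_def G'_def)
qed

lemma qcnj_in_halfspace_iff [simp]: "qcnj q \<in> \<bbbH>\<^sup>+ \<longleftrightarrow> q \<in> \<bbbH>\<^sup>+"
  by (simp add: quat_halfspace_def)

text \<open>
  The density \<open>exp (- t qcnj w)\<close> reproduces, since its conjugate is the kernel \<open>exp (- t w)\<close> of the
  Laplace transform at \<open>w\<close>. If \<open>G\<close> is the density of another reproducing element, then the transform
  of the difference \<open>D\<close> of the two densities has the same inner product with both elements, so that the
  integral of \<open>(norm D)\<^sup>2\<close> is \<open>0\<close>.
\<close>

lemma k_H2_halfspace_eq: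
  assumes w: "w \<in> \<bbbH>\<^sup>+" and z: "z \<in> \<bbbH>\<^sup>+"
  shows "k_H2_halfspace w z = laplace (\<lambda>t. exp (- (t *\<^sub>R qcnj w))) z"
proof -
  let ?E = "\<lambda>t. exp (- (t *\<^sub>R qcnj w))"
  define k where "k = restrict (laplace ?E) \<bbbH>\<^sup>+"
  have k: "laplace_density k ?E"
    using L2_halfline_exp[of "qcnj w"] w by (simp add: laplace_density_iff k_def)
  have repr: "f w = inner_H2_halfspace f k" if "laplace_density f F" for f F
    using that w by (simp add: inner_H2_halfspace_eq[OF that k] qcnj_exp)
      (simp add: laplace_density_iff laplace_def)
  have "reproducing_kernel H2_halfspace inner_H2_halfspace w = k"
    unfolding reproducing_kernel_def
  proof (rule the_equality)
    show "k \<in> H2_halfspace \<and> (\<forall>f\<in>H2_halfspace. f w = inner_H2_halfspace f k)"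
      using k repr by (auto simp: H2_halfspace_def)
  next
    fix k'
    assume k': "k' \<in> H2_halfspace \<and> (\<forall>f\<in>H2_halfspace. f w = inner_H2_halfspace f k')"
    then obtain G where G: "laplace_density k' G"
      by (auto simp: H2_halfspace_def)
    define D where "D t = G t - ?E t" for t
    define d where "d = restrict (laplace D) \<bbbH>\<^sup>+"
    have L2: "L2_halfline G" "L2_halfline ?E" "L2_halfline D"
      using G k unfolding D_def by (auto simp: laplace_density_iff intro: L2_halfline_diff)
    then have d: "laplace_density d D"
      by (simp add: laplace_density_iff d_def)
    have "inner_H2_halfspace d k' = inner_H2_halfspace d k"
      using k' d repr[OF d] by (auto simp: H2_halfspace_def)
    then have "(LBINT t:{0<..}. qcnj (G t) * D t) = (LBINT t:{0<..}. qcnj (?E t) * D t)"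
      by (simp add: inner_H2_halfspace_eq[OF d G] inner_H2_halfspace_eq[OF d k])
    moreover have "(LBINT t:{0<..}. qcnj (G t) * D t - qcnj (?E t) * D t)
        = (LBINT t:{0<..}. qcnj (G t) * D t) - (LBINT t:{0<..}. qcnj (?E t) * D t)"
      by (intro set_integral_diff(2) L2_halfline_mult_integrable L2_halfline_qcnj L2)
    moreover have "qcnj (G t) * D t - qcnj (?E t) * D t = qcnj (D t) * D t" for t
      by (simp add: D_def left_diff_distrib)
    ultimately have "(LBINT t:{0<..}. qcnj (D t) * D t) = 0"
      by simp
    then have "(LBINT t:{0<..}. of_real ((norm (D t))\<^sup>2) :: quat) = 0"
      by (simp add: qcnj_mult of_real_def)
    moreover have "indicator {0<..} t *\<^sub>R of_real ((norm (D t))\<^sup>2)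
        = (of_real (indicator {0<..} t *\<^sub>R (norm (D t))\<^sup>2) :: quat)" for t :: real
      by (simp add: indicator_def)
    moreover have "integrable lborel (\<lambda>t. indicator {0<..} t *\<^sub>R (norm (D t))\<^sup>2)"
      using L2(3) by (simp only: L2_halfline_def set_integrable_def)
    ultimately have "of_real (LBINT t. indicator {0<..} t *\<^sub>R (norm (D t))\<^sup>2) = (0 :: quat)"
      by (simp only: set_lebesgue_integral_def integral_bounded_linear[OF bounded_linear_of_real])
    then have "(LBINT t. indicator {0<..} t *\<^sub>R (norm (D t))\<^sup>2) = 0"
      by (simp only: of_real_eq_0_iff)
    then have "AE t in lborel. indicator {0<..} t *\<^sub>R (norm (D t))\<^sup>2 = 0"
      using L2(3) by (subst (asm) integral_nonneg_eq_0_iff_AE)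
        (auto simp: L2_halfline_def set_integrable_def)
    then have AE: "AE t in lborel. indicator {0<..} t *\<^sub>R (exp (- (t *\<^sub>R q)) * D t) = 0" for q
      by eventually_elim auto
    have "laplace G q = laplace ?E q" if "q \<in> \<bbbH>\<^sup>+" for q
    proof -
      have "laplace D q = 0"
        unfolding laplace_def set_lebesgue_integral_def by (rule integral_eq_zero_AE[OF AE])
      moreover have "laplace D q = laplace G q - laplace ?E q"
        using laplace_integrable[OF _ that] L2
        by (simp add: laplace_def D_def right_diff_distrib set_integral_diff)
      ultimately show ?thesis by simp
    qed
    then show "k' = k"
      using G by (auto simp: laplace_density_iff k_def)
  qed
  then show ?thesis
    using z by (simp add: k_H2_halfspace_def k_def)
qed

section \<open>The kernels as solutions of linear equations\<close>

text \<open>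
  Multiplying the series by \<open>q\<close> on the left and by \<open>qcnj p\<close> on the right removes its first term.
\<close>

lemma ball_kernel_equation:
  assumes "p \<in> \<bbbB>" and "q \<in> \<bbbB>"
  shows "k_H2_ball p q - q * k_H2_ball p q * qcnj p = 1"
proof -
  let ?u = "\<lambda>n. q ^ n * qcnj p ^ n"
  have s: "summable ?u"
    using assms by (intro summable_mult_of_square_summable square_summable_powers) auto
  have "(\<lambda>n. q * ?u n * qcnj p) sums (q * suminf ?u * qcnj p)"
    by (intro sums_mult sums_mult2 summable_sums s)
  then have "q * suminf ?u * qcnj p = (\<Sum>n. q * ?u n * qcnj p)"
    by (rule sums_unique)
  also have "\<dots> = (\<Sum>n. ?u (Suc n))"
    by (simp add: mult.assoc power_commutes)
  also have "\<dots> = suminf ?u - ?u 0"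
    by (rule suminf_split_head[OF s])
  finally show ?thesis
    by (simp add: k_H2_ball_eq[OF assms])
qed

lemma stein_equation_unique:
  fixes p q X Y :: "'a :: real_normed_div_algebra"
  assumes "norm p < 1" "norm q < 1" and "X - q * X * p = Y - q * Y * p"
  shows "X = Y"
proof (rule ccontr)
  assume "X \<noteq> Y"
  have "X - Y = q * (X - Y) * p"
    using assms(3) by (simp add: algebra_simps)
  then have "norm (X - Y) = (norm q * norm p) * norm (X - Y)"
    by (metis mult.commute mult.left_commute norm_mult)
  moreover have "norm q * norm p < 1"
    using assms by (metis mult_strict_mono' mult_1 norm_ge_zero)
  ultimately show False
    using \<open>X \<noteq> Y\<close> by simp
qed

text \<open>
  The integrand \<open>g t = exp (- t z) exp (- t qcnj w)\<close> satisfies \<open>z g t + g t qcnj w = - g' t\<close>, and it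
  equals \<open>1\<close> at \<open>0\<close> and tends to \<open>0\<close> at infinity.
\<close>

lemma halfspace_kernel_equation:
  assumes w: "w \<in> \<bbbH>\<^sup>+" and z: "z \<in> \<bbbH>\<^sup>+"
  shows "z * k_H2_halfspace w z + k_H2_halfspace w z * qcnj w = 1"
proof -
  let ?g = "\<lambda>t. exp (- (t *\<^sub>R z)) * exp (- (t *\<^sub>R qcnj w))"
  let ?g' = "\<lambda>t. z * ?g t + ?g t * qcnj w"
  have int: "set_integrable lborel {0<..} ?g"
    using w z by (intro L2_halfline_mult_integrable L2_halfline_exp) auto
  have left: "set_integrable lborel {0<..} (\<lambda>t. z * ?g t)"
      "(LBINT t:{0<..}. z * ?g t) = z * (LBINT t:{0<..}. ?g t)"
    and right: "set_integrable lborel {0<..} (\<lambda>t. ?g t * qcnj w)"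
      "(LBINT t:{0<..}. ?g t * qcnj w) = (LBINT t:{0<..}. ?g t) * qcnj w"
  proof -
    let ?h = "\<lambda>t. indicator {0<..} t *\<^sub>R ?g t"
    have h: "integrable lborel ?h"
      using int by (simp only: set_integrable_def)
    have l: "indicator {0<..} t *\<^sub>R (z * ?g t) = z * ?h t"
      and r: "indicator {0<..} t *\<^sub>R (?g t * qcnj w) = ?h t * qcnj w" for t
      by (simp_all only: mult_scaleR_right mult_scaleR_left)
    show "set_integrable lborel {0<..} (\<lambda>t. z * ?g t)"
      "(LBINT t:{0<..}. z * ?g t) = z * (LBINT t:{0<..}. ?g t)"
      unfolding set_integrable_def set_lebesgue_integral_def l
      by (rule integrable_mult_right[OF h], rule Bochner_Integration.integral_mult_right[OF h])
    show "set_integrable lborel {0<..} (\<lambda>t. ?g t * qcnj w)"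
      "(LBINT t:{0<..}. ?g t * qcnj w) = (LBINT t:{0<..}. ?g t) * qcnj w"
      unfolding set_integrable_def set_lebesgue_integral_def r
      by (rule integrable_mult_left[OF h], rule Bochner_Integration.integral_mult_left[OF h])
  qed
  have deriv: "((\<lambda>t. - ?g t) has_vector_derivative ?g' t) (at t)" for t
  proof -
    have "((\<lambda>t. exp (t *\<^sub>R (- z)) * exp (t *\<^sub>R (- qcnj w))) has_vector_derivative
        exp (t *\<^sub>R (- z)) * (exp (t *\<^sub>R (- qcnj w)) * (- qcnj w)) + (- z * exp (t *\<^sub>R (- z))) * exp (t *\<^sub>R (- qcnj w))) (at t)"
      by (intro has_vector_derivative_mult exp_scaleR_has_vector_derivative_left
          exp_scaleR_has_vector_derivative_right)
    from has_vector_derivative_minus[OF this] show ?thesis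
      by (simp add: mult.assoc add.commute)
  qed
  have norm_g: "norm (?g t) = exp (- (t * (qRe z + qRe w)))" for t
    by (simp add: norm_mult norm_exp_quat distrib_left flip: exp_add)
  have cont: "isCont ?g t" for t
    by (intro continuous_mult isCont_exp_scaleR)
  have "(LBINT t=0..\<infinity>. ?g' t) = 0 - (-1)"
  proof (rule interval_integral_FTC_integrable[where F = "\<lambda>t. - ?g t"])
    show "set_integrable lborel (einterval 0 \<infinity>) ?g'"
      using set_integral_add(1)[OF left(1) right(1)] by (simp add: zero_ereal_def)
    have "((\<lambda>t. - ?g t) \<longlongrightarrow> - ?g 0) (at_right 0)"
      using isCont_minus[OF cont[of 0]] by (simp add: isCont_def filterlim_at_split)
    then show "(((\<lambda>t. - ?g t) \<circ> real_of_ereal) \<longlongrightarrow> -1) (at_right 0)"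
      by (simp add: ereal_tendsto_simps zero_ereal_def)
    have "((\<lambda>t. norm (?g t)) \<longlongrightarrow> 0) at_top"
      unfolding norm_g using w z
      by (intro filterlim_compose[OF exp_at_bot])
        (auto simp: quat_halfspace_def filterlim_uminus_at_bot filterlim_ident
          intro!: filterlim_at_top_mult_tendsto_pos[OF tendsto_const])
    then have "((\<lambda>t. - ?g t) \<longlongrightarrow> - 0) at_top"
      by (intro tendsto_minus) (rule tendsto_norm_zero_cancel)
    then show "(((\<lambda>t. - ?g t) \<circ> real_of_ereal) \<longlongrightarrow> 0) (at_left \<infinity>)"
      by (simp add: ereal_tendsto_simps)
  qed (use deriv cont in \<open>auto intro!: continuous_intros\<close>)
  then have "(LBINT t:{0<..}. ?g' t) = 1"
    by (simp add: interval_lebesgue_integral_0_infty)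
  moreover have "(LBINT t:{0<..}. ?g' t) = z * (LBINT t:{0<..}. ?g t) + (LBINT t:{0<..}. ?g t) * qcnj w"
    by (simp only: set_integral_add(2)[OF left(1) right(1)] left(2) right(2))
  ultimately show ?thesis
    by (simp add: k_H2_halfspace_eq[OF assms] laplace_def)
qed

section \<open>Comparison under the Cayley map\<close>

theorem proposition5p1:
  fixes z w :: quat
  assumes "z \<in> \<bbbH>\<^sup>+" and "w \<in> \<bbbH>\<^sup>+"
  shows "k_H2_ball (cayley_inv w) (cayley_inv z) =
           (1 / 2) * (1 + z) * k_H2_halfspace w z * (1 + qcnj w)"
proof -
  define p where "p = cayley_inv w"
  define q where "q = cayley_inv z"
  define K where "K = k_H2_halfspace w z"
  define X where "X = (1 / 2) * (1 + z) * K * (1 + qcnj w)"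
  have ne: "1 + z \<noteq> 0" "1 + w \<noteq> 0"
    using assms by (auto simp: quat_halfspace_def quat_eq_iff)
  have ne': "1 + qcnj w \<noteq> 0"
    using ne(2) by (metis qcnj_simps(2,4,8,1))
  have ball: "p \<in> \<bbbB>" "q \<in> \<bbbB>"
    unfolding p_def q_def using assms ne cayley_inv_in_ball_iff by blast+
  \<comment> \<open>As a real scalar, the factor \<open>1 / 2\<close> can be moved past the quaternions.\<close>
  have half: "(1 / 2) * x = x /\<^sub>R 2" for x :: quat
  proof -
    have "(1 / 2 :: quat) = of_real (inverse 2)"
      by (simp only: divide_inverse mult_1 of_real_inverse of_real_numeral)
    then show ?thesis
      by (simp only: scaleR_conv_of_real)
  qed
  have q_mult: "q * (1 + z) = z - 1"
  proof -
    have "(z - 1) * (1 + z) = (1 + z) * (z - 1)"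
      by (simp add: algebra_simps)
    then have "q * (1 + z) = inverse (1 + z) * ((1 + z) * (z - 1))"
      by (simp add: q_def cayley_inv_def mult.assoc)
    then show ?thesis
      using ne(1) by (simp flip: mult.assoc)
  qed
  have p_mult: "(1 + qcnj w) * qcnj p = qcnj w - 1"
  proof -
    have "qcnj p = (qcnj w - 1) * inverse (1 + qcnj w)"
      by (simp add: p_def cayley_inv_def qcnj_inverse)
    moreover have "(1 + qcnj w) * (qcnj w - 1) = (qcnj w - 1) * (1 + qcnj w)"
      by (simp add: algebra_simps)
    ultimately have "(1 + qcnj w) * qcnj p = (qcnj w - 1) * (1 + qcnj w) * inverse (1 + qcnj w)"
      by (simp flip: mult.assoc)
    then show ?thesis
      using ne' by (simp add: mult.assoc)
  qed
  have X: "X = ((1 + z) * K * (1 + qcnj w)) /\<^sub>R 2"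
    by (simp add: X_def half mult.assoc)
  have "q * X * qcnj p = ((q * (1 + z)) * K * ((1 + qcnj w) * qcnj p)) /\<^sub>R 2"
    by (simp add: X mult.assoc)
  also have "\<dots> = ((z - 1) * K * (qcnj w - 1)) /\<^sub>R 2"
    by (simp only: q_mult p_mult)
  finally have "X - q * X * qcnj p = ((1 + z) * K * (1 + qcnj w) - (z - 1) * K * (qcnj w - 1)) /\<^sub>R 2"
    by (simp add: X scaleR_diff_right)
  also have "(1 + z) * K * (1 + qcnj w) - (z - 1) * K * (qcnj w - 1) = 2 *\<^sub>R (z * K + K * qcnj w)"
    by (simp add: algebra_simps scaleR_2)
  finally have "X - q * X * qcnj p = 1"
    using halfspace_kernel_equation[OF assms(2,1)] by (simp add: K_def)
  then have "k_H2_ball p q - q * k_H2_ball p q * qcnj p = X - q * X * qcnj p"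
    using ball_kernel_equation[OF ball] by simp
  then have "k_H2_ball p q = X"
    by (rule stein_equation_unique[rotated 2]) (use ball in simp_all)
  then show ?thesis
    by (simp only: p_def q_def X_def K_def)
qed

end
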